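(* Let $\mathcal{F}$ be a financial network in which every bank uses an edge-ranking rule. Then $\mathcal{F}$ admits no positive debt swap, i.e., there are no two edges $e_1=(u_1,v_1)$, $e_2=(u_2,v_2)$ whose debt swap $\sigma$ satisfies both $a^\sigma_{v_1}>a_{v_1}$ and $a^\sigma_{v_2}>a_{v_2}$.
   Context: A financial network $\mathcal{F}=(G,\mathbf{l},\mathbf{a}^x,\mathbf{f})$ consists of a finite directed graph $G=(V,E)$ without loops or parallel edges (nodes are banks), a liability $l_e\in\mathbb{N}_{>0}$ for each edge $e=(u,w)$ (bank $u$ owes bank $w$ the amount $l_e$), external assets $a^x_v\in\mathbb{N}$ for each bank $v$, and an allocation rule $\mathbf{f}$ assigning to every outgoing edge $e\in E^+(v)$ of bank $v$ a payment function $f_e:\mathbb{R}_{\ge 0}\to[0,l_e]$ which is continuous and non-decreasing, such that $\sum_{e\in E^+(v)}f_e(b)=\min\{b,L_v\}$ for all $b\ge0$, where $L_v=\sum_{e\in E^+(v)}l_e$. $E^-(v)$ denotes the incoming edges of $v$. A vector $(b_v)_{v\in V}\ge 0$ is feasible if $b_v=a^x_v+\sum_{e=(u,v)\in E^-(v)}f_e(b_u)$ for all $v$; the feasible vectors form a complete lattice, and the clearing state consists of the pointwise maximal feasible vector $(a_v)_{v\in V}$ (the total assets) and the payments $p_e=f_e(a_u)$ for $e=(u,w)$. In an edge-ranking rule, each bank $v$ has a linear order $\pi_v(1),\pi_v(2),\dots$ of $E^+(v)$ and pays its available assets to these edges in this order, paying each edge fully before paying the next one, until its assets are exhausted or all edges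 are fully paid. A debt swap $\sigma$ of two edges $e_1=(u_1,v_1)$, $e_2=(u_2,v_2)$ with $l_{e_1}=l_{e_2}$ and $u_1,v_1,u_2,v_2$ pairwise distinct yields the network $\mathcal{F}^\sigma$ obtained by removing $e_1,e_2$ and adding $(u_1,v_2)$ and $(u_2,v_1)$, both with liability $l_{e_1}$, where $(u_1,v_2)$ takes over the payment function of $e_1$ (in particular its position in $u_1$'s ranking) and $(u_2,v_1)$ takes over that of $e_2$; all else is unchanged. $v_1,v_2$ are the creditors of the swap; $a_w$ and $a^\sigma_w$ denote total assets in the clearing states of $\mathcal{F}$ and $\mathcal{F}^\sigma$. A swap is positive if $a^\sigma_{v_1}>a_{v_1}$ and $a^\sigma_{v_2}>a_{v_2}$. *)

theory Defs
  imports "HOL-Analysis.Analysis" "Graph_Theory.Digraph"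
begin

record ('v, 'e) network =
  net_graph :: "('v, 'e) pre_digraph"
  liab :: "'e \<Rightarrow> nat"
  ext :: "'v \<Rightarrow> nat"
  pay :: "'e \<Rightarrow> real \<Rightarrow> real"

definition total_liab :: "('v, 'e) network \<Rightarrow> 'v \<Rightarrow> nat" where
  "total_liab N v = (\<Sum>e\<in>out_arcs (net_graph N) v. liab N e)"

text \<open>
  Edges are abstract arcs with a tail (the debtor) and a head (the creditor). The first locale
  permits loops and parallel arcs; the networks of interest are those of the second locale.
  The first one is there because a swap can create an arc parallel to an existing one.
\<close>

locale multi_network =
  fixes N :: "('v, 'e) network"
  assumes fin_graph: "fin_digraph (net_graph N)"
    and liab_pos: "e \<in> arcs (net_graph N) \<Longrightarrow> 0 < liab N e"
    and pay_range: "e \<in> arcs (net_graph N) \<Longrightarrow> 0 \<le> b \<Longrightarrow> 0 \<le> pay N e b \<and> pay N e b \<le> real (liab N e)"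
    and pay_continuous: "e \<in> arcs (net_graph N) \<Longrightarrow> continuous_on {0..} (pay N e)"
    and pay_mono: "e \<in> arcs (net_graph N) \<Longrightarrow> mono_on {0..} (pay N e)"
    and pay_sum: "v \<in> verts (net_graph N) \<Longrightarrow> 0 \<le> b \<Longrightarrow>
      (\<Sum>e\<in>out_arcs (net_graph N) v. pay N e b) = min b (real (total_liab N v))"

locale financial_network = multi_network N for N :: "('v, 'e) network" +
  assumes simple_graph: "digraph (net_graph N)"

text \<open>
  A vector indexed by the banks is a function that vanishes outside the vertex set, so that the
  pointwise order on functions is the pointwise order on vectors.
\<close>

definition feasible :: "('v, 'e) network \<Rightarrow> ('v \<Rightarrow> real) \<Rightarrow> bool" where
  "feasible N b \<longleftrightarrow>
    (\<forall>v. v \<notin> verts (net_graph N) \<longrightarrow> b v = 0) \<and>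
    (\<forall>v\<in>verts (net_graph N). 0 \<le> b v \<and>
      b v = real (ext N v) + (\<Sum>e\<in>in_arcs (net_graph N) v. pay N e (b (tail (net_graph N) e))))"

text \<open>
  The order is pointwise, so this is the greatest feasible vector. Lemma
  \<open>total_assets_greatest\<close> below shows that it exists.
\<close>

definition total_assets :: "('v, 'e) network \<Rightarrow> 'v \<Rightarrow> real" where
  "total_assets N = (GREATEST b. feasible N b)"

text \<open>
  The arc of rank \<open>i\<close> receives what is left after the arcs of smaller rank have been paid,
  but at least nothing and at most its own liability.
\<close>

definition edge_ranking_bank :: "('v, 'e) network \<Rightarrow> 'v \<Rightarrow> bool" where
  "edge_ranking_bank N v \<longleftrightarrow>
    (\<exists>\<pi>. bij_betw \<pi> {1..card (out_arcs (net_graph N) v)} (out_arcs (net_graph N) v) \<and>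
      (\<forall>i\<in>{1..card (out_arcs (net_graph N) v)}. \<forall>b\<ge>0.
        pay N (\<pi> i) b =
          min (real (liab N (\<pi> i))) (max 0 (b - (\<Sum>j\<in>{1..<i}. real (liab N (\<pi> j)))))))"

definition edge_ranking :: "('v, 'e) network \<Rightarrow> bool" where
  "edge_ranking N \<longleftrightarrow> (\<forall>v\<in>verts (net_graph N). edge_ranking_bank N v)"

definition debt_swap :: "('v, 'e) network \<Rightarrow> 'e \<Rightarrow> 'e \<Rightarrow> bool" where
  "debt_swap N e1 e2 \<longleftrightarrow>
    e1 \<in> arcs (net_graph N) \<and> e2 \<in> arcs (net_graph N) \<and> liab N e1 = liab N e2 \<and>
    distinct [tail (net_graph N) e1, head (net_graph N) e1, tail (net_graph N) e2, head (net_graph N) e2]"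

text \<open>
  The arc \<open>e1\<close> itself becomes the new arc \<open>(u1, v2)\<close>, and \<open>e2\<close> becomes \<open>(u2, v1)\<close>: they keep their
  tail, liability and payment function, and only their heads are exchanged.
\<close>

definition swapped :: "('v, 'e) network \<Rightarrow> 'e \<Rightarrow> 'e \<Rightarrow> ('v, 'e) network" where
  "swapped N e1 e2 = N\<lparr>net_graph := (net_graph N)\<lparr>head := (head (net_graph N))
     (e1 := head (net_graph N) e2, e2 := head (net_graph N) e1)\<rparr>\<rparr>"

definition positive_swap :: "('v, 'e) network \<Rightarrow> 'e \<Rightarrow> 'e \<Rightarrow> bool" where
  "positive_swap N e1 e2 \<longleftrightarrow> debt_swap N e1 e2 \<and>
    total_assets (swapped N e1 e2) (head (net_graph N) e1) > total_assets N (head (net_graph N) e1) \<and>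
    total_assets (swapped N e1 e2) (head (net_graph N) e2) > total_assets N (head (net_graph N) e2)"

lemma (in multi_network) greatest_feasible_exists:
  "\<exists>s. feasible N s \<and> (\<forall>b. feasible N b \<longrightarrow> b \<le> s)"
proof -
  interpret fin_digraph "net_graph N" by (rule fin_graph)
  let ?V = "verts (net_graph N)"
  let ?t = "tail (net_graph N)"
  define \<Phi> where "\<Phi> b v = (if v \<in> ?V then real (ext N v) +
    (\<Sum>e\<in>in_arcs (net_graph N) v. pay N e (b (?t e))) else 0)" for b v
  define U where "U v = real (ext N v) + (\<Sum>e\<in>in_arcs (net_graph N) v. real (liab N e))" for v
  define S where "S = {b. (\<forall>v. 0 \<le> b v) \<and> (\<forall>v. v \<notin> ?V \<longrightarrow> b v = 0) \<and> (\<forall>v. b v \<le> \<Phi> b v)}"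
  define s where "s v = (SUP b\<in>S. b v)" for v
  have \<Phi>_nonneg: "0 \<le> \<Phi> b v" if "\<And>v. 0 \<le> b v" for b v
    using pay_range that by (auto simp: \<Phi>_def intro!: add_nonneg_nonneg sum_nonneg)
  have \<Phi>_U: "\<Phi> b v \<le> U v" if "\<And>v. 0 \<le> b v" for b v
  proof -
    have "0 \<le> U v" by (auto simp: U_def intro!: add_nonneg_nonneg sum_nonneg)
    moreover have "(\<Sum>e\<in>in_arcs (net_graph N) v. pay N e (b (?t e)))
        \<le> (\<Sum>e\<in>in_arcs (net_graph N) v. real (liab N e))"
      using pay_range that by (intro sum_mono) auto
    ultimately show ?thesis by (auto simp: \<Phi>_def U_def)
  qed
  have \<Phi>_mono: "\<Phi> b v \<le> \<Phi> c v" if "\<And>v. 0 \<le> b v" "\<And>v. b v \<le> c v" for b c v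
  proof -
    have "0 \<le> c v" for v using that order_trans by blast
    then have "pay N e (b (?t e)) \<le> pay N e (c (?t e))" if "e \<in> arcs (net_graph N)" for e
      using \<open>\<And>v. 0 \<le> b v\<close> \<open>\<And>v. b v \<le> c v\<close> by (intro mono_onD[OF pay_mono[OF that]]) auto
    then show ?thesis by (auto simp: \<Phi>_def intro!: sum_mono)
  qed
  have zero: "(\<lambda>_. 0) \<in> S" using \<Phi>_nonneg by (auto simp: S_def)
  have bdd: "bdd_above ((\<lambda>b. b v) ` S)" for v
  proof (rule bdd_aboveI2)
    fix b assume "b \<in> S"
    then show "b v \<le> U v" using \<Phi>_U[of b v] by (auto simp: S_def intro: order_trans)
  qed
  have upper: "b v \<le> s v" if "b \<in> S" for b v
    unfolding s_def using that bdd by (rule cSUP_upper)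
  have s_nonneg: "0 \<le> s v" for v using upper[OF zero] by simp
  have s_le: "s v \<le> \<Phi> s v" for v
    unfolding s_def[of v]
  proof (rule cSUP_least)
    show "S \<noteq> {}" using zero by blast
    fix b assume b: "b \<in> S"
    then have "b v \<le> \<Phi> b v" by (simp add: S_def)
    also have "\<dots> \<le> \<Phi> s v" using b upper by (intro \<Phi>_mono) (auto simp: S_def)
    finally show "b v \<le> \<Phi> s v" .
  qed
  have "\<Phi> s \<in> S"
    using \<Phi>_nonneg[of s] s_nonneg s_le \<Phi>_mono[of s "\<Phi> s"] by (simp add: S_def) (simp add: \<Phi>_def)
  then have s_eq: "s v = \<Phi> s v" for v using upper s_le by (meson order_antisym)
  have "feasible N s" unfolding feasible_def
  proof (intro conjI allI ballI impI)
    fix v assume "v \<notin> ?V" then show "s v = 0" by (subst s_eq) (simp add: \<Phi>_def)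
  next
    fix v assume "v \<in> ?V"
    then show "s v = real (ext N v) + (\<Sum>e\<in>in_arcs (net_graph N) v. pay N e (s (?t e)))"
      by (subst s_eq) (simp add: \<Phi>_def)
  qed (rule s_nonneg)
  moreover have "b \<le> s" if b: "feasible N b" for b
  proof -
    have nonneg: "0 \<le> b v" for v using b unfolding feasible_def by (metis order_refl)
    have "b v = \<Phi> b v" for v
    proof (cases "v \<in> ?V")
      case True
      then have eq: "\<Phi> b v = real (ext N v) + (\<Sum>e\<in>in_arcs (net_graph N) v. pay N e (b (?t e)))"
        by (simp add: \<Phi>_def)
      show ?thesis unfolding eq using b True unfolding feasible_def by blast
    next
      case False
      then have "b v = 0" using b unfolding feasible_def by blast
      with False show ?thesis by (simp add: \<Phi>_def)
    qed
    then have "b v \<le> \<Phi> b v" for v by (metis order_refl)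
    moreover have "v \<notin> ?V \<Longrightarrow> b v = 0" for v using b unfolding feasible_def by blast
    ultimately have "b \<in> S" using nonneg unfolding S_def by blast
    then show ?thesis using upper by (simp add: le_fun_def)
  qed
  ultimately show ?thesis by blast
qed

lemma (in multi_network) total_assets_greatest:
  "feasible N (total_assets N)" "feasible N b \<Longrightarrow> b \<le> total_assets N"
proof -
  obtain s where s: "feasible N s" "\<And>b. feasible N b \<Longrightarrow> b \<le> s"
    using greatest_feasible_exists by blast
  then have "total_assets N = s" unfolding total_assets_def by (intro Greatest_equality) auto
  with s show "feasible N (total_assets N)" "feasible N b \<Longrightarrow> b \<le> total_assets N" by auto
qed

lemma swapped_simps [simp]:
  "verts (net_graph (swapped N e1 e2)) = verts (net_graph N)"
  "arcs (net_graph (swapped N e1 e2)) = arcs (net_graph N)"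
  "tail (net_graph (swapped N e1 e2)) = tail (net_graph N)"
  "head (net_graph (swapped N e1 e2)) =
    (head (net_graph N))(e1 := head (net_graph N) e2, e2 := head (net_graph N) e1)"
  "liab (swapped N e1 e2) = liab N"
  "ext (swapped N e1 e2) = ext N"
  "pay (swapped N e1 e2) = pay N"
  by (simp_all add: swapped_def)

lemma out_arcs_swapped [simp]: "out_arcs (net_graph (swapped N e1 e2)) v = out_arcs (net_graph N) v"
  by (auto simp: out_arcs_def)

lemma (in multi_network) multi_network_swapped:
  assumes "debt_swap N e1 e2"
  shows "multi_network (swapped N e1 e2)"
proof -
  interpret fin_digraph "net_graph N" by (rule fin_graph)
  have "fin_digraph (net_graph (swapped N e1 e2))"
    using assms by unfold_locales (auto simp: debt_swap_def)
  then show ?thesis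
    using liab_pos pay_range pay_continuous pay_mono pay_sum
    by (auto simp: multi_network_def total_liab_def)
qed

lemma (in financial_network) financial_network_swapped:
  assumes swap: "debt_swap N e1 e2"
    and new: "(tail (net_graph N) e1, head (net_graph N) e2) \<notin> arcs_ends (net_graph N)"
      "(tail (net_graph N) e2, head (net_graph N) e1) \<notin> arcs_ends (net_graph N)"
  shows "financial_network (swapped N e1 e2)"
proof -
  interpret digraph "net_graph N" by (rule simple_graph)
  interpret sw: multi_network "swapped N e1 e2" by (rule multi_network_swapped[OF swap])
  interpret G: fin_digraph "net_graph (swapped N e1 e2)" by (rule sw.fin_graph)
  have "digraph (net_graph (swapped N e1 e2))"
  proof unfold_locales
    fix e assume "e \<in> arcs (net_graph (swapped N e1 e2))"
    then show "tail (net_graph (swapped N e1 e2)) e \<noteq> head (net_graph (swapped N e1 e2)) e"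
      using swap no_loops by (auto simp: debt_swap_def)
  next
    fix e e' assume e: "e \<in> arcs (net_graph (swapped N e1 e2))" "e' \<in> arcs (net_graph (swapped N e1 e2))"
      and eq: "arc_to_ends (net_graph (swapped N e1 e2)) e = arc_to_ends (net_graph (swapped N e1 e2)) e'"
    show "e = e'"
    proof (rule ccontr)
      assume "e \<noteq> e'"
      then have "\<not> (tail (net_graph N) e = tail (net_graph N) e' \<and> head (net_graph N) e = head (net_graph N) e')"
        using e no_multi_arcs by (auto simp: arc_to_ends_def)
      moreover have "(tail (net_graph N) x, head (net_graph N) x) \<in> arcs_ends (net_graph N)"
        if "x \<in> arcs (net_graph N)" for x
        using that by (auto simp: arcs_ends_conv)
      ultimately show False
        using e eq new swap \<open>e \<noteq> e'\<close>
        by (auto simp: arc_to_ends_def debt_swap_def split: if_splits) metis+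
    qed
  qed
  then show ?thesis
    by (simp add: financial_network_def financial_network_axioms_def sw.multi_network_axioms)
qed

lemma edge_ranking_swapped [simp]: "edge_ranking (swapped N e1 e2) \<longleftrightarrow> edge_ranking N"
  by (simp add: edge_ranking_def edge_ranking_bank_def)

end

theory Submission
  imports Defs
begin

text \<open>
  Let \<open>a\<close> and \<open>b\<close> be the clearing vectors before and after a positive swap, and let \<open>c\<close> be their
  pointwise maximum. At the two creditors \<open>c\<close> agrees with \<open>b\<close>, and at all other banks both networks
  have the same inflow, so by monotonicity the inflow of \<open>c\<close> in the swapped network is at least \<open>c\<close>.
  A bank cannot pay more than it owns, so raising the assets from \<open>a\<close> to \<open>c\<close> cannot
  raise the total inflow by more than \<open>c - a\<close>. Hence \<open>c\<close> is a fixed point of the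
  swapped network, and every bank of \<open>D = {v. a v < c v}\<close> has assets below its
  liabilities at \<open>a\<close>. With edge rankings, the next small amount that a bank of \<open>D\<close> would receive
  goes to a single arc, whose head again lies in \<open>D\<close>: either it is one of the creditors, or its
  inflow is the same in both networks and strictly larger for \<open>c\<close> than for \<open>a\<close>.
  Following these arcs within the finite set \<open>D\<close> yields a cycle of the original network along which
  a small amount can be added to \<open>a\<close>, so \<open>a\<close> is not the greatest feasible vector.
\<close>

definition inflow :: "('v, 'e) network \<Rightarrow> ('v \<Rightarrow> real) \<Rightarrow> 'v \<Rightarrow> real" where
  "inflow N b v = real (ext N v) +
     (\<Sum>e\<in>in_arcs (net_graph N) v. pay N e (b (tail (net_graph N) e)))"

lemma feasible_iff_inflow:
  "feasible N b \<longleftrightarrow> (\<forall>v. v \<notin> verts (net_graph N) \<longrightarrow> b v = 0) \<and>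
     (\<forall>v\<in>verts (net_graph N). 0 \<le> b v \<and> inflow N b v = b v)"
  unfolding feasible_def inflow_def 
  by (intro conj_cong ball_cong refl) (rule eq_commute)

lemma inflow_swapped:
  assumes "e1 \<in> arcs (net_graph N)" "e2 \<in> arcs (net_graph N)"
    and "v \<noteq> head (net_graph N) e1" "v \<noteq> head (net_graph N) e2"
  shows "inflow (swapped N e1 e2) b v = inflow N b v"
proof -
  have "in_arcs (net_graph (swapped N e1 e2)) v = in_arcs (net_graph N) v"
    using assms by (auto simp: in_arcs_def split: if_splits)
  then show ?thesis by (simp add: inflow_def)
qed

text \<open>A minimal nonempty subset that \<open>g\<close> maps into itself works, since its image
  is another such subset. Surjectivity is what matters later: every member has a predecessor inside
  \<open>C\<close>, as on a cycle.\<close>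

lemma finite_self_map_invariant_subset:
  assumes "finite D" "D \<noteq> {}" "g ` D \<subseteq> D"
  obtains C where "C \<subseteq> D" "C \<noteq> {}" "g ` C = C"
proof -
  define \<C> where "\<C> = {C. C \<subseteq> D \<and> C \<noteq> {} \<and> g ` C \<subseteq> C}"
  have "finite \<C>" using assms(1) by (simp add: \<C>_def)
  moreover have "\<C> \<noteq> {}" using assms by (auto simp: \<C>_def)
  ultimately obtain C where C: "C \<in> \<C>" "\<And>B. B \<in> \<C> \<Longrightarrow> B \<subseteq> C \<Longrightarrow> C = B"
    using finite_has_minimal[of \<C>] by blast
  from C(1) have "g ` C \<in> \<C>" "g ` C \<subseteq> C" unfolding \<C>_def by auto
  then have "g ` C = C" using C(2) by metis
  with C(1) that show ?thesis by (auto simp: \<C>_def)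
qed

text \<open>The arc is the first one in the ranking whose cumulative liability exceeds
  \<open>b\<close>; it absorbs all further money until it is full.\<close>

lemma edge_ranking_next_arc:
  assumes "edge_ranking_bank N v" and "0 \<le> b" and "b < real (total_liab N v)"
  obtains e \<delta> where "e \<in> out_arcs (net_graph N) v" "0 < \<delta>"
    "\<And>t. 0 \<le> t \<Longrightarrow> t \<le> \<delta> \<Longrightarrow> pay N e (b + t) = pay N e b + t"
proof -
  let ?k = "card (out_arcs (net_graph N) v)"
  obtain \<pi> where bij: "bij_betw \<pi> {1..?k} (out_arcs (net_graph N) v)"
    and pay: "\<And>i b. i \<in> {1..?k} \<Longrightarrow> 0 \<le> b \<Longrightarrow> pay N (\<pi> i) b =
      min (real (liab N (\<pi> i))) (max 0 (b - (\<Sum>j\<in>{1..<i}. real (liab N (\<pi> j)))))"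
    using assms(1) unfolding edge_ranking_bank_def by blast
  define S where "S i = (\<Sum>j\<in>{1..<Suc i}. real (liab N (\<pi> j)))" for i
  have "S ?k = real (total_liab N v)"
    using sum.reindex_bij_betw[OF bij, of "\<lambda>e. real (liab N e)"]
    by (simp add: S_def total_liab_def atLeastLessThanSuc_atLeastAtMost)
  then have "b < S ?k" using assms(3) by simp
  define i where "i = (LEAST i. b < S i)"
  have i: "b < S i" and ik: "i \<le> ?k"
    unfolding i_def
    using LeastI[of "\<lambda>i. b < S i", OF \<open>b < S ?k\<close>] Least_le[of "\<lambda>i. b < S i", OF \<open>b < S ?k\<close>]
    by simp_all
  \<comment> \<open>Rank 0 belongs to no arc; it is excluded because \<open>S 0\<close> is an empty
    sum and \<open>b\<close> is nonnegative.\<close>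
  have "i \<noteq> 0" using i assms(2) by (intro notI) (simp add: S_def)
  then obtain m where m: "i = Suc m" using not0_implies_Suc by blast
  have "\<not> b < S m" using not_less_Least[of m "\<lambda>i. b < S i"] m by (simp add: i_def)
  then have Sm: "S m \<le> b" by simp
  have Si: "S i = S m + real (liab N (\<pi> i))" by (simp add: S_def m)
  have i_mem: "i \<in> {1..?k}" using ik m by simp
  show ?thesis
  proof
    show "\<pi> i \<in> out_arcs (net_graph N) v" using bij i_mem by (auto simp: bij_betw_def)
    show "0 < S i - b" using i by simp
    fix t :: real assume t: "0 \<le> t" "t \<le> S i - b"
    have "pay N (\<pi> i) (b + s) = b + s - S m" if "0 \<le> s" "s \<le> S i - b" for s
      using pay[OF i_mem, of "b + s"] that assms(2) Sm Si by (simp add: S_def m)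
    from this[of 0] this[of t] show "pay N (\<pi> i) (b + t) = pay N (\<pi> i) b + t"
      using t i by simp
  qed
qed

context multi_network
begin

sublocale fin_digraph "net_graph N" by (rule fin_graph)

abbreviation "V \<equiv> verts (net_graph N)"

text \<open>Double counting: each payment is grouped once by the head of its arc and once by the
  tail.\<close>

lemma sum_inflow:
  assumes "\<And>v. v \<in> V \<Longrightarrow> 0 \<le> b v"
  shows "(\<Sum>v\<in>V. inflow N b v) = (\<Sum>v\<in>V. real (ext N v) + min (b v) (real (total_liab N v)))"
proof -
  let ?f = "\<lambda>e. pay N e (b (tail (net_graph N) e))"
  have "(\<Sum>v\<in>V. \<Sum>e\<in>in_arcs (net_graph N) v. ?f e) = (\<Sum>e\<in>arcs (net_graph N). ?f e)"
    unfolding in_arcs_def by (rule sum.group) auto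
  also have "\<dots> = (\<Sum>v\<in>V. \<Sum>e\<in>out_arcs (net_graph N) v. ?f e)"
    unfolding out_arcs_def by (rule sum.group[symmetric]) auto
  also have "\<dots> = (\<Sum>v\<in>V. \<Sum>e\<in>out_arcs (net_graph N) v. pay N e (b v))"
    by (intro sum.cong) auto
  also have "\<dots> = (\<Sum>v\<in>V. min (b v) (real (total_liab N v)))"
    using assms by (intro sum.cong) (auto simp: pay_sum)
  finally show ?thesis by (simp add: inflow_def sum.distrib)
qed

lemma inflow_mono:
  assumes "\<And>v. v \<in> V \<Longrightarrow> 0 \<le> a v" "\<And>v. v \<in> V \<Longrightarrow> a v \<le> d v"
  shows "inflow N a v \<le> inflow N d v"
  unfolding inflow_def
proof (intro add_left_mono sum_mono)
  fix e assume "e \<in> in_arcs (net_graph N) v"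
  then have e: "e \<in> arcs (net_graph N)" by simp
  then show "pay N e (a (tail (net_graph N) e)) \<le> pay N e (d (tail (net_graph N) e))"
    using assms[of "tail (net_graph N) e"] by (intro mono_onD[OF pay_mono[OF e]]) auto
qed

lemma inflow_head_increase:
  assumes "\<And>v. v \<in> V \<Longrightarrow> 0 \<le> a v" "\<And>v. v \<in> V \<Longrightarrow> a v \<le> d v"
    and e: "e \<in> arcs (net_graph N)"
  shows "inflow N a (head (net_graph N) e) +
      (pay N e (d (tail (net_graph N) e)) - pay N e (a (tail (net_graph N) e)))
    \<le> inflow N d (head (net_graph N) e)"
proof -
  let ?t = "tail (net_graph N)" and ?I = "in_arcs (net_graph N) (head (net_graph N) e)"
  let ?inc = "\<lambda>e. pay N e (d (?t e)) - pay N e (a (?t e))"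
  have "0 \<le> ?inc e'" if "e' \<in> ?I" for e'
  proof -
    have e': "e' \<in> arcs (net_graph N)" using that by simp
    show ?thesis
      using assms(1,2)[of "?t e'"] e' mono_onD[OF pay_mono[OF e'], of "a (?t e')" "d (?t e')"]
      by auto
  qed
  then have "?inc e \<le> (\<Sum>e\<in>?I. ?inc e)" using e by (intro member_le_sum) auto
  then show ?thesis by (simp add: inflow_def sum_subtractf)
qed

text \<open>\<open>?p v\<close> is the excess of inflow over assets and \<open>?q v\<close> the part
  of the increase that is not paid on. Both are nonnegative, and by the balance of \<open>a\<close>
  they sum to zero over all banks. Only the total balance of \<open>a\<close> is assumed, so
  \<open>a\<close> may be feasible for a different network with the same external assets and total
  liabilities.\<close>

lemma no_loss_above_balanced:
  assumes bal: "(\<Sum>v\<in>V. a v) = (\<Sum>v\<in>V. real (ext N v) + min (a v) (real (total_liab N v)))"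
    and nonneg: "\<And>v. v \<in> V \<Longrightarrow> 0 \<le> a v" and le: "\<And>v. v \<in> V \<Longrightarrow> a v \<le> d v"
    and post: "\<And>v. v \<in> V \<Longrightarrow> d v \<le> inflow N d v"
    and v: "v \<in> V"
  shows "inflow N d v = d v"
    and "d v - a v = min (d v) (real (total_liab N v)) - min (a v) (real (total_liab N v))"
proof -
  let ?L = "\<lambda>v. real (total_liab N v)"
  let ?p = "\<lambda>v. inflow N d v - d v"
  let ?q = "\<lambda>v. (d v - a v) - (min (d v) (?L v) - min (a v) (?L v))"
  have d: "\<And>v. v \<in> V \<Longrightarrow> 0 \<le> d v" using nonneg le order_trans by blast
  have p: "0 \<le> ?p v" if "v \<in> V" for v using post[OF that] by simp
  have q: "0 \<le> ?q v" if "v \<in> V" for v using le[OF that] by (auto simp: min_def)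
  have "(\<Sum>v\<in>V. ?p v + ?q v) = 0"
    using bal sum_inflow[of d, OF d] by (simp add: sum.distrib sum_subtractf)
  then have "?p v + ?q v = 0"
    using sum_nonneg_0[of V "\<lambda>v. ?p v + ?q v", OF _ add_nonneg_nonneg[OF p q] _ v] by simp
  with p[OF v] q[OF v]
  have "?p v = 0" "?q v = 0" by linarith+
  then show "inflow N d v = d v" "d v - a v = min (d v) (?L v) - min (a v) (?L v)"
    by linarith+
qed

lemma feasible_balanced:
  assumes "feasible N a"
  shows "(\<Sum>v\<in>V. a v) = (\<Sum>v\<in>V. real (ext N v) + min (a v) (real (total_liab N v)))"
  using assms sum_inflow[of a] by (simp add: feasible_iff_inflow)

lemma closed_next_arcs_not_greatest:
  assumes a: "feasible N a" and D: "D \<subseteq> V" "D \<noteq> {}"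
    and arc: "\<And>u. u \<in> D \<Longrightarrow> n u \<in> out_arcs (net_graph N) u"
    and closed: "\<And>u. u \<in> D \<Longrightarrow> head (net_graph N) (n u) \<in> D"
    and \<delta>: "\<And>u. u \<in> D \<Longrightarrow> 0 < \<delta> u"
    and step: "\<And>u t. u \<in> D \<Longrightarrow> 0 \<le> t \<Longrightarrow> t \<le> \<delta> u \<Longrightarrow> pay N (n u) (a u + t) = pay N (n u) (a u) + t"
  obtains d where "feasible N d" "\<not> d \<le> a"
proof -
  let ?g = "\<lambda>u. head (net_graph N) (n u)"
  have "finite D" using D(1) by (rule finite_subset) simp
  then obtain C where C: "C \<subseteq> D" "C \<noteq> {}" "?g ` C = C"
    using finite_self_map_invariant_subset[of D ?g] D(2) closed by blast
  \<comment> \<open>One amount that every next arc in \<open>D\<close> can still pass on in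
    full.\<close>
  define \<epsilon> where "\<epsilon> = Min (\<delta> ` D)"
  have "0 < \<epsilon>" and \<epsilon>_le: "\<And>u. u \<in> D \<Longrightarrow> \<epsilon> \<le> \<delta> u"
    using \<open>finite D\<close> D(2) \<delta> by (auto simp: \<epsilon>_def)
  define d where "d v = (if v \<in> C then a v + \<epsilon> else a v)" for v
  have nonneg: "\<And>v. v \<in> V \<Longrightarrow> 0 \<le> a v" and fp: "\<And>v. v \<in> V \<Longrightarrow> inflow N a v = a v"
    and outside: "\<And>v. v \<notin> V \<Longrightarrow> a v = 0"
    using a by (auto simp: feasible_iff_inflow)
  have le: "\<And>v. a v \<le> d v" using \<open>0 < \<epsilon>\<close> by (simp add: d_def)
  have d0: "\<And>v. v \<in> V \<Longrightarrow> 0 \<le> d v" using nonneg le order_trans by blast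
  have post: "d v \<le> inflow N d v" if v: "v \<in> V" for v
  proof (cases "v \<in> C")
    \<comment> \<open>The extra amount at \<open>v\<close> is financed by a predecessor
      \<open>u\<close> in \<open>C\<close>, which passes on its own extra amount along
      \<open>n u\<close>.\<close>
    case True
    then obtain u where u: "u \<in> C" "v = ?g u" using C(3) by blast
    then have uD: "u \<in> D" using C(1) by blast
    have "pay N (n u) (d u) = pay N (n u) (a u) + \<epsilon>"
      using step[OF uD, of \<epsilon>] \<open>0 < \<epsilon>\<close> \<epsilon>_le[OF uD] u by (simp add: d_def)
    moreover have "inflow N a v + (pay N (n u) (d u) - pay N (n u) (a u)) \<le> inflow N d v"
      using inflow_head_increase[of a d "n u"] nonneg le arc[OF uD] u(2) by simp
    ultimately show ?thesis using fp[OF v] True by (simp add: d_def)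
  next
    case False
    then show ?thesis using inflow_mono[of a d v] nonneg le fp[OF v] by (simp add: d_def)
  qed
  have "inflow N d v = d v" if "v \<in> V" for v
    using no_loss_above_balanced(1)[OF feasible_balanced[OF a] nonneg le post that] .
  moreover have "d v = 0" if "v \<notin> V" for v using that outside C(1) D(1) by (auto simp: d_def)
  ultimately have "feasible N d"
    using d0 by (auto simp: feasible_iff_inflow)
  moreover have "\<not> d \<le> a" using C(2) \<open>0 < \<epsilon>\<close> by (auto simp: d_def le_fun_def)
  ultimately show ?thesis by (rule that)
qed

lemma no_positive_swap:
  assumes rank: "edge_ranking N"
  shows "\<not> positive_swap N e1 e2"
proof
  assume "positive_swap N e1 e2"
  let ?M = "swapped N e1 e2" and ?h = "head (net_graph N)"
  let ?L = "\<lambda>v. real (total_liab N v)"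
  define a where "a = total_assets N"
  define b where "b = total_assets ?M"
  define c where "c v = max (a v) (b v)" for v
  have swap: "debt_swap N e1 e2" and pos: "a (?h e1) < b (?h e1)" "a (?h e2) < b (?h e2)"
    using \<open>positive_swap N e1 e2\<close> by (auto simp: positive_swap_def a_def b_def)
  interpret M: multi_network ?M by (rule multi_network_swapped[OF swap])
  have e: "e1 \<in> arcs (net_graph N)" "e2 \<in> arcs (net_graph N)"
    using swap by (auto simp: debt_swap_def)
  have LM: "total_liab ?M = total_liab N" by (simp add: total_liab_def fun_eq_iff)
  have a: "feasible N a" unfolding a_def by (rule total_assets_greatest)
  have b: "feasible ?M b" unfolding b_def by (rule M.total_assets_greatest)
  have a0: "\<And>v. v \<in> V \<Longrightarrow> 0 \<le> a v" and fpa: "\<And>v. v \<in> V \<Longrightarrow> inflow N a v = a v"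
    using a by (auto simp: feasible_iff_inflow)
  have b0: "\<And>v. v \<in> V \<Longrightarrow> 0 \<le> b v" and fpb: "\<And>v. v \<in> V \<Longrightarrow> inflow ?M b v = b v"
    using b by (auto simp: feasible_iff_inflow)
  have ac: "\<And>v. a v \<le> c v" and bc: "\<And>v. b v \<le> c v" by (auto simp: c_def)
  have post: "c v \<le> inflow ?M c v" if v: "v \<in> V" for v
  proof -
    have "b v \<le> inflow ?M c v" using M.inflow_mono[of b c v] b0 bc fpb[OF v] by simp
    \<comment> \<open>The second alternative covers the two creditors, where the inflow depends on
      the network.\<close>
    moreover have "a v \<le> inflow ?M c v \<or> a v < b v"
      using inflow_mono[of a c v] a0 ac fpa[OF v] inflow_swapped[OF e, of v c] pos
      by (cases "v \<in> {?h e1, ?h e2}") auto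
    ultimately show ?thesis by (auto simp: c_def max_def)
  qed
  have fpc: "inflow ?M c v = c v"
    and no_loss: "c v - a v = min (c v) (?L v) - min (a v) (?L v)" if "v \<in> V" for v
    \<comment> \<open>The balance of \<open>a\<close> carries over to \<open>?M\<close> although
      \<open>a\<close> need not be feasible there.\<close>
    using M.no_loss_above_balanced[of a c v] feasible_balanced[OF a] a0 ac post that
    by (simp_all add: LM)
  define D where "D = {v \<in> V. a v < c v}"
  have hD: "?h e1 \<in> D" "?h e2 \<in> D" using pos e by (auto simp: D_def c_def)
  have "\<exists>f \<delta>. f \<in> out_arcs (net_graph N) u \<and> 0 < \<delta> \<and>
      (\<forall>t. 0 \<le> t \<and> t \<le> \<delta> \<longrightarrow> pay N f (a u + t) = pay N f (a u) + t)" if "u \<in> D" for u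
  proof -
    have u: "u \<in> V" "a u < c u" using that by (auto simp: D_def)
    \<comment> \<open>Otherwise both minima would equal \<open>?L u\<close>, forcing
      \<open>c u = a u\<close>.\<close>
    have "a u < ?L u" using no_loss[OF u(1)] u(2) by (auto simp: min_def split: if_splits)
    with rank u(1) show ?thesis
      using edge_ranking_next_arc[of N u "a u"] a0[OF u(1)] unfolding edge_ranking_def by metis
  qed
  then obtain n \<delta> where n: "\<And>u. u \<in> D \<Longrightarrow> n u \<in> out_arcs (net_graph N) u"
    and \<delta>: "\<And>u. u \<in> D \<Longrightarrow> 0 < \<delta> u"
    and step: "\<And>u t. u \<in> D \<Longrightarrow> 0 \<le> t \<Longrightarrow> t \<le> \<delta> u \<Longrightarrow> pay N (n u) (a u + t) = pay N (n u) (a u) + t"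
    by metis
  have closed: "?h (n u) \<in> D" if u: "u \<in> D" for u
  proof (cases "?h (n u) \<in> {?h e1, ?h e2}")
    case True
    then show ?thesis using hD by auto
  next
    case False
    have uV: "u \<in> V" "a u < c u" using u by (auto simp: D_def)
    have nu: "n u \<in> arcs (net_graph N)" "tail (net_graph N) (n u) = u" using n[OF u] by auto
    \<comment> \<open>Small enough for \<open>step\<close> to apply and for \<open>a u + t\<close>
      to stay below or at \<open>c u\<close>.\<close>
    define t where "t = min (\<delta> u) (c u - a u)"
    have t: "0 < t" "t \<le> \<delta> u" "a u + t \<le> c u" using \<delta>[OF u] uV(2) by (auto simp: t_def)
    have "pay N (n u) (a u) < pay N (n u) (a u + t)" using step[OF u, of t] t by simp
    also have "\<dots> \<le> pay N (n u) (c u)"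
      using a0[OF uV(1)] t by (intro mono_onD[OF pay_mono[OF nu(1)]]) auto
    finally have "inflow N a (?h (n u)) < inflow N c (?h (n u))"
      using inflow_head_increase[of a c "n u"] a0 ac nu by simp
    moreover have "?h (n u) \<in> V" using nu by simp
    moreover have "inflow ?M c (?h (n u)) = inflow N c (?h (n u))"
      using False by (intro inflow_swapped[OF e]) auto
    ultimately show ?thesis using fpa fpc by (simp add: D_def)
  qed
  have "D \<subseteq> V" "D \<noteq> {}" using hD by (auto simp: D_def)
  then obtain d where "feasible N d" "\<not> d \<le> a"
    using closed_next_arcs_not_greatest[of a D n \<delta>] a n closed \<delta> step by blast
  then show False using total_assets_greatest(2) unfolding a_def by blast
qed

end

theorem theorem1:
  fixes N :: "('v, 'e) network"
  assumes "financial_network N"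
    and "edge_ranking N"
  shows "\<not> (\<exists>e1 e2. positive_swap N e1 e2)"
proof -
  interpret financial_network N by (rule assms(1))
  show ?thesis using no_positive_swap[OF assms(2)] by blast
qed

end
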